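(* Let $\mathbb{K}$ be an algebraically closed field and let $u_1,u_2,u_3\in\mathbb{K}[t_1,t_2]$ be nonzero homogeneous polynomials of the same degree $d\geq 1$ without common factors. Let $\phi:\mathbb{P}^1\to\mathbb{P}^2$, $(t_1:t_2)\mapsto(u_1(\underline{t}):u_2(\underline{t}):u_3(\underline{t}))$, and $\mathrm{C}:=\phi(\mathbb{P}^1)$. If the parametrization $\phi$ has $\mu=1$, then the map $\phi$ is generically one-to-one onto $\mathrm{C}$.
   Context: The syzygy module $\{(a,b,c)\in\mathbb{K}[t_1,t_2]^3:\ au_1+bu_2+cu_3=0\}$ is a free graded $\mathbb{K}[t_1,t_2]$-module of rank 2 with a homogeneous basis whose elements have degrees $\mu$ and $d-\mu$, where $0\le\mu\le d/2$; this defines $\mu$. "Generically one-to-one onto $\mathrm{C}$" means that $\#\phi^{-1}(\mathbf{p})=1$ for a generic point $\mathbf{p}\in\mathrm{C}$. *)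

theory Defs
  imports "HOL-Analysis.Analysis" "HOL-Library.Poly_Mapping"
begin

section \<open>Polynomials in variables indexed by a finite type\<close>

text \<open>A monomial is its finitely supported exponent vector, a polynomial its finitely supported
  coefficient function; multiplication on \<open>\<Rightarrow>\<^sub>0\<close> is convolution, so \<open>('a, 2) mpoly\<close> is the ring
  \<open>K[t\<^sub>1, t\<^sub>2]\<close>, and \<open>dvd\<close> is divisibility in it.\<close>

type_synonym ('a, 'n) mpoly = "('n \<Rightarrow>\<^sub>0 nat) \<Rightarrow>\<^sub>0 'a"

text \<open>The zero polynomial is homogeneous of every degree.\<close>

definition homogeneous :: "nat \<Rightarrow> ('a::zero, 'n::finite) mpoly \<Rightarrow> bool" where
  "homogeneous d p \<longleftrightarrow> (\<forall>m \<in> Poly_Mapping.keys p. (\<Sum>i\<in>UNIV. Poly_Mapping.lookup m i) = d)"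

definition mpoly_eval :: "('a::comm_semiring_1, 'n::finite) mpoly \<Rightarrow> 'a ^ 'n \<Rightarrow> 'a" where
  "mpoly_eval p v =
     (\<Sum>m \<in> Poly_Mapping.keys p.
        Poly_Mapping.lookup p m * (\<Prod>i\<in>UNIV. (v $ i) ^ Poly_Mapping.lookup m i))"

lemma mpoly_eval_scale:
  assumes "homogeneous d p"
  shows "mpoly_eval p (c *s v) = c ^ d * mpoly_eval p v"
proof -
  have "Poly_Mapping.lookup p m * (\<Prod>i\<in>UNIV. ((c *s v) $ i) ^ Poly_Mapping.lookup m i) =
        c ^ d * (Poly_Mapping.lookup p m * (\<Prod>i\<in>UNIV. (v $ i) ^ Poly_Mapping.lookup m i))"
    if "m \<in> Poly_Mapping.keys p" for m
  proof -
    have "d = (\<Sum>i\<in>UNIV. Poly_Mapping.lookup m i)"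
      using assms that by (simp add: homogeneous_def)
    then show ?thesis
      by (simp add: power_mult_distrib prod.distrib power_sum mult_ac)
  qed
  then show ?thesis
    by (simp add: mpoly_eval_def sum_distrib_left)
qed

section \<open>Projective space and its Zariski topology\<close>

text \<open>\<open>('a, 'n)\<close>-projective space has dimension \<open>CARD('n) - 1\<close>. Its points are the classes of
  nonzero vectors up to nonzero scalars.\<close>

definition proj_rel :: "(('a::field) ^ ('n::finite)) rel" where
  "proj_rel = {(v, w). v \<noteq> 0 \<and> w \<noteq> 0 \<and> (\<exists>c. w = c *s v)}"

definition proj_space :: "(('a::field) ^ ('n::finite)) set set" where
  "proj_space = (UNIV - {0}) // proj_rel"

lemma equiv_proj_rel: "equiv (UNIV - {0}) (proj_rel :: (('a::field) ^ ('n::finite)) rel)"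
proof (rule equivI)
  show "proj_rel \<subseteq> (UNIV - {0}) \<times> (UNIV - {0 :: 'a ^ 'n})"
    by (auto simp: proj_rel_def)
  show "refl_on (UNIV - {0}) (proj_rel :: ('a ^ 'n) rel)"
    by (auto simp: refl_on_def proj_rel_def intro!: exI[of _ 1])
  show "sym (proj_rel :: ('a ^ 'n) rel)"
  proof (rule symI)
    fix v w :: "'a ^ 'n"
    assume "(v, w) \<in> proj_rel"
    then obtain c where c: "v \<noteq> 0" "w \<noteq> 0" "w = c *s v"
      unfolding proj_rel_def by blast
    then have "c \<noteq> 0" by auto
    then have "inverse c *s w = v"
      by (simp add: c(3) vector_smult_assoc)
    then have "\<exists>b. v = b *s w" by metis
    with c(1,2) show "(w, v) \<in> proj_rel"
      unfolding proj_rel_def by blast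
  qed
  show "trans (proj_rel :: ('a ^ 'n) rel)"
  proof (rule transI)
    fix v w x :: "'a ^ 'n"
    assume "(v, w) \<in> proj_rel" "(w, x) \<in> proj_rel"
    then obtain a b where vx: "v \<noteq> 0" "x \<noteq> 0" and "w = a *s v" "x = b *s w"
      unfolding proj_rel_def by blast
    then have "x = (b * a) *s v"
      by (simp only: vector_smult_assoc)
    then have "\<exists>c. x = c *s v" by (rule exI)
    with vx show "(v, x) \<in> proj_rel"
      unfolding proj_rel_def by blast
  qed
qed

text \<open>Open sets are generated by the nonvanishing loci of homogeneous polynomials.
  (By \<open>mpoly_eval_scale\<close>, nonvanishing does not depend on the representative.)\<close>

definition zariski :: "(('a::field) ^ ('n::finite)) set topology" where
  "zariski = topology_generated_by
     {{P \<in> proj_space. \<forall>v \<in> P. mpoly_eval F v \<noteq> 0} | F. \<exists>k. homogeneous k F}"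

lemma topspace_zariski: "topspace (zariski :: (('a::field) ^ ('n::finite)) set topology) = proj_space"
proof -
  have "homogeneous 0 (1 :: ('a, 'n) mpoly)" "mpoly_eval (1 :: ('a, 'n) mpoly) v = 1" for v
    by (simp_all add: homogeneous_def mpoly_eval_def lookup_one)
  then have "proj_space \<in> {{P \<in> proj_space. \<forall>v \<in> P. mpoly_eval F v \<noteq> 0} |
      F :: ('a, 'n) mpoly. \<exists>k. homogeneous k F}"
    by (auto intro!: exI[of _ "1 :: ('a, 'n) mpoly"])
  then show ?thesis
    unfolding zariski_def topology_generated_by_topspace by blast
qed

text \<open>A property holds for a generic point of \<open>C\<close> if it holds on a dense open subset of \<open>C\<close>.\<close>

definition for_generic ::
  "(('a::field) ^ ('n::finite)) set set \<Rightarrow> (('a ^ 'n) set \<Rightarrow> bool) \<Rightarrow> bool" where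
  "for_generic C \<Psi> \<longleftrightarrow>
     (\<exists>U. openin (subtopology zariski C) U \<and> subtopology zariski C closure_of U = C \<and> (\<forall>P \<in> U. \<Psi> P))"

section \<open>Rational parametrizations\<close>

text \<open>The point \<open>(u\<^sub>1(v) : \<dots> : u\<^sub>m(v))\<close>; the union is over representatives \<open>v\<close> of the argument,
  which all yield the same class.\<close>

definition param_map ::
  "(('a::field), ('n::finite)) mpoly ^ ('m::finite) \<Rightarrow> ('a ^ 'n) set \<Rightarrow> ('a ^ 'm) set" where
  "param_map u P = (\<Union>v \<in> P. proj_rel `` {\<chi> i. mpoly_eval (u $ i) v})"

lemma param_map_class:
  fixes u :: "(('a::field), ('n::finite)) mpoly ^ ('m::finite)"
  assumes u: "\<And>i. homogeneous d (u $ i)" and v: "v \<noteq> 0"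
  shows "param_map u (proj_rel `` {v}) = proj_rel `` {\<chi> i. mpoly_eval (u $ i) v}"
proof -
  let ?e = "\<lambda>v. \<chi> i. mpoly_eval (u $ i) v"
  have "proj_rel `` {?e w} = proj_rel `` {?e v}" if "w \<in> proj_rel `` {v}" for w
  proof -
    from that obtain c where c: "w = c *s v" "w \<noteq> 0"
      by (auto simp: proj_rel_def)
    then have "c \<noteq> 0" by auto
    have e: "?e w = c ^ d *s ?e v"
      by (simp add: vec_eq_iff c mpoly_eval_scale[OF u])
    show ?thesis
    proof (cases "?e v = 0")
      case True
      with e have "?e w = 0" by (simp add: vec_eq_iff)
      then show ?thesis using True by simp
    next
      case False
      with e \<open>c \<noteq> 0\<close> have "(?e v, ?e w) \<in> proj_rel"
        by (auto simp: proj_rel_def vec_eq_iff)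
      then show ?thesis
        by (rule equiv_class_eq[OF equiv_proj_rel, symmetric])
    qed
  qed
  moreover have "v \<in> proj_rel `` {v}"
    using equiv_class_self[OF equiv_proj_rel] v by blast
  then have "(\<Union>w \<in> proj_rel `` {v}. proj_rel `` {?e v}) = proj_rel `` {?e v}"
    by auto
  ultimately show ?thesis
    unfolding param_map_def by (metis (no_types, lifting) SUP_cong)
qed

definition generically_one_to_one ::
  "(('a::field), ('n::finite)) mpoly ^ ('m::finite) \<Rightarrow> bool" where
  "generically_one_to_one u \<longleftrightarrow>
     for_generic (param_map u ` proj_space)
       (\<lambda>Q. card {P \<in> proj_space. param_map u P = Q} = 1)"

section \<open>Syzygies\<close>

definition syzygies :: "'r::comm_ring_1 ^ ('m::finite) \<Rightarrow> ('r ^ 'm) set" where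
  "syzygies u = {a. (\<Sum>i\<in>UNIV. a $ i * u $ i) = 0}"

text \<open>Justifies using the library notions of span and independence over a polynomial ring.\<close>

lemma module_vec: "module ((*s) :: 'r::comm_ring_1 \<Rightarrow> 'r ^ ('m::finite) \<Rightarrow> 'r ^ 'm)"
  by unfold_locales (simp_all add: vec_eq_iff algebra_simps)

text \<open>The relation ``\<open>\<mu>\<close> is the \<open>\<mu>\<close> of the parametrization \<open>u\<close> of degree \<open>d\<close>'': the syzygy
  module is free on two homogeneous elements, of degrees \<open>\<mu> \<le> d / 2\<close> and \<open>d - \<mu>\<close>.\<close>

definition has_mu :: "(('a::field), 2) mpoly ^ 3 \<Rightarrow> nat \<Rightarrow> nat \<Rightarrow> bool" where
  "has_mu u d \<mu> \<longleftrightarrow> 2 * \<mu> \<le> d \<and>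
     (\<exists>p q. p \<noteq> q \<and> (\<forall>i. homogeneous \<mu> (p $ i)) \<and> (\<forall>i. homogeneous (d - \<mu>) (q $ i)) \<and>
            \<not> module.dependent (*s) {p, q} \<and> module.span (*s) {p, q} = syzygies u)"

end

theory Submission
  imports Defs
begin

text \<open>
  Let \<open>p\<close> be the basis syzygy of degree 1. If \<open>Q = \<phi>(w)\<close>, then \<open>w\<close> lies in the kernel of the linear
  form \<open>w \<mapsto> p(w) \<bullet> Q\<close> on \<open>K\<^sup>2\<close>. Fix \<open>e\<close> with \<open>p(e) \<noteq> 0\<close>. If \<open>p(e) \<bullet> Q \<noteq> 0\<close>, this kernel has dimension
  at most one, so \<open>w\<close> is the only point over \<open>Q\<close>. The condition \<open>p(e) \<bullet> Q \<noteq> 0\<close> is open, and it is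
  not identically violated on \<open>C\<close>: otherwise \<open>p(e)\<close> would be a nonzero constant syzygy, whereas all
  elements of the basis have positive degree and so vanish at the origin. It is then satisfied on a
  dense subset of \<open>C\<close>, because an open set that meets the image of a line in
  \<open>K\<^sup>2\<close> misses only finitely many parameters.
\<close>

section \<open>Evaluation of polynomials\<close>

text \<open>In a finite field \<open>\<Prod>(X - a)\<close> over all \<open>a\<close> vanishes
  everywhere, so adding 1 gives a polynomial of positive degree without roots.\<close>

lemma infinite_UNIV_alg_closed_field: "infinite (UNIV :: 'a::alg_closed_field set)"
proof
  assume fin: "finite (UNIV :: 'a set)"
  define p :: "'a poly" where "p = (\<Prod>a\<in>UNIV. [:- a, 1:])"
  have "degree p = card (UNIV :: 'a set)"
    unfolding p_def by (subst degree_prod_eq_sum_degree) auto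
  moreover have "card (UNIV :: 'a set) > 0"
    using fin by (simp add: card_gt_0_iff)
  ultimately have "degree (p + 1) > 0"
    by (subst degree_add_eq_left) auto
  then obtain x where "poly (p + 1) x = 0"
    using alg_closed_imp_poly_has_root by blast
  moreover have "poly p x = 0"
    unfolding p_def poly_prod using fin by (intro prod_zero) auto
  ultimately show False by simp
qed

text \<open>Allows several polynomials to be evaluated over one common set of monomials.\<close>

lemma mpoly_eval_superset:
  assumes "finite A" "Poly_Mapping.keys p \<subseteq> A"
  shows "mpoly_eval p v =
    (\<Sum>m\<in>A. Poly_Mapping.lookup p m * (\<Prod>i\<in>UNIV. (v $ i) ^ Poly_Mapping.lookup m i))"
  unfolding mpoly_eval_def using assms
  by (intro sum.mono_neutral_left) (auto simp: in_keys_iff)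

lemma mpoly_eval_zero [simp]: "mpoly_eval 0 v = 0"
  by (simp add: mpoly_eval_def)

lemma mpoly_eval_add: "mpoly_eval (p + q) v = mpoly_eval p v + mpoly_eval q v"
proof -
  let ?A = "Poly_Mapping.keys p \<union> Poly_Mapping.keys q"
  have "Poly_Mapping.keys (p + q) \<subseteq> ?A" by (rule keys_add)
  then show ?thesis
    by (simp add: mpoly_eval_superset[of ?A] lookup_add algebra_simps sum.distrib)
qed

lemma mpoly_eval_sum: "mpoly_eval (\<Sum>i\<in>A. f i) v = (\<Sum>i\<in>A. mpoly_eval (f i) v)"
  by (induction A rule: infinite_finite_induct) (simp_all add: mpoly_eval_add)

lemma mpoly_eval_single:
  "mpoly_eval (Poly_Mapping.single m c) v = c * (\<Prod>i\<in>UNIV. (v $ i) ^ Poly_Mapping.lookup m i)"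
  by (cases "c = 0") (simp_all add: mpoly_eval_def)

lemma mpoly_eval_const [simp]: "mpoly_eval (Poly_Mapping.single 0 c) v = c"
  by (simp add: mpoly_eval_single)

lemma mpoly_eval_one [simp]: "mpoly_eval 1 v = 1"
  using mpoly_eval_const[of 1 v] by simp

lemma poly_mapping_eq_sum_single:
  "p = (\<Sum>m\<in>Poly_Mapping.keys p. Poly_Mapping.single m (Poly_Mapping.lookup p m))"
  by (rule poly_mapping_eqI)
    (auto simp: lookup_sum lookup_single when_def in_keys_iff)

lemma mpoly_eval_mult: "mpoly_eval (p * q) v = mpoly_eval p v * mpoly_eval q v"
proof -
  let ?P = "\<lambda>m. Poly_Mapping.single m (Poly_Mapping.lookup p m)"
  let ?Q = "\<lambda>m. Poly_Mapping.single m (Poly_Mapping.lookup q m)"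
  have "p * q = (\<Sum>m\<in>Poly_Mapping.keys p. \<Sum>n\<in>Poly_Mapping.keys q. ?P m * ?Q n)"
    using sum_product[of ?P "Poly_Mapping.keys p" ?Q "Poly_Mapping.keys q"]
    by (simp only: poly_mapping_eq_sum_single[symmetric])
  then have "mpoly_eval (p * q) v =
      (\<Sum>m\<in>Poly_Mapping.keys p. \<Sum>n\<in>Poly_Mapping.keys q. mpoly_eval (?P m) v * mpoly_eval (?Q n) v)"
    by (simp add: mpoly_eval_sum mult_single mpoly_eval_single lookup_add power_add prod.distrib mult_ac)
  also have "\<dots> = mpoly_eval p v * mpoly_eval q v"
    unfolding mpoly_eval_single mpoly_eval_def[of p] mpoly_eval_def[of q] sum_product ..
  finally show ?thesis .
qed

lemma mpoly_eval_diff: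
  fixes p q :: "('a::comm_ring_1, 'n::finite) mpoly"
  shows "mpoly_eval (p - q) v = mpoly_eval p v - mpoly_eval q v"
  using mpoly_eval_add[of "p - q" q v] by simp

text \<open>Restricting to a polynomially parametrized curve reduces nonvanishing conditions to
  roots of a univariate polynomial.\<close>

lemma mpoly_eval_poly_curve:
  fixes F :: "('a::field, 'n::finite) mpoly"
  shows "\<exists>g. \<forall>t. mpoly_eval F (\<chi> i. poly (f i) t) = poly g t"
proof (intro exI allI)
  fix t
  show "mpoly_eval F (\<chi> i. poly (f i) t) =
    poly (\<Sum>m\<in>Poly_Mapping.keys F. smult (Poly_Mapping.lookup F m)
      (\<Prod>i\<in>UNIV. f i ^ Poly_Mapping.lookup m i)) t"
    by (simp add: mpoly_eval_def poly_sum poly_prod)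
qed

section \<open>Homogeneous polynomials\<close>

lemma homogeneous_add: "homogeneous d p \<Longrightarrow> homogeneous d q \<Longrightarrow> homogeneous d (p + q)"
  unfolding homogeneous_def using keys_add[of p q] by blast

lemma homogeneous_zero [simp]: "homogeneous d 0"
  by (simp add: homogeneous_def)

lemma homogeneous_sum: "(\<And>i. i \<in> A \<Longrightarrow> homogeneous d (f i)) \<Longrightarrow> homogeneous d (\<Sum>i\<in>A. f i)"
  by (induction A rule: infinite_finite_induct)
    (simp_all add: homogeneous_add)

lemma homogeneous_mult:
  assumes "homogeneous d p" "homogeneous e q"
  shows "homogeneous (d + e) (p * q)"
  unfolding homogeneous_def
proof
  fix m assume "m \<in> Poly_Mapping.keys (p * q)"
  then obtain a b where "m = a + b" "a \<in> Poly_Mapping.keys p" "b \<in> Poly_Mapping.keys q"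
    using keys_mult[of p q] by blast
  with assms show "(\<Sum>i\<in>UNIV. Poly_Mapping.lookup m i) = d + e"
    by (simp add: homogeneous_def lookup_add sum.distrib)
qed

lemma homogeneous_single:
  "(\<Sum>i\<in>UNIV. Poly_Mapping.lookup m i) = d \<Longrightarrow> homogeneous d (Poly_Mapping.single m c)"
  by (auto simp: homogeneous_def)

lemma homogeneous_variable:
  fixes i :: "'n::finite"
  shows "homogeneous 1 (Poly_Mapping.single (Poly_Mapping.single i 1) c)"
  by (rule homogeneous_single) (simp add: lookup_single when_def)

lemma mpoly_eval_variable:
  fixes i :: "'n::finite"
  shows "mpoly_eval (Poly_Mapping.single (Poly_Mapping.single i 1) c) v = c * v $ i"
proof -
  have "(\<Prod>j\<in>UNIV. (v $ j) ^ Poly_Mapping.lookup (Poly_Mapping.single i 1) j) =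
      (\<Prod>j\<in>UNIV. if i = j then v $ j else 1)"
    by (intro prod.cong) (auto simp: lookup_single when_def)
  then show ?thesis by (simp add: mpoly_eval_single)
qed

lemma mpoly_eval_at_0:
  assumes "homogeneous d p" "d > 0"
  shows "mpoly_eval p 0 = 0"
  using mpoly_eval_scale[OF assms(1), of 0 0] assms(2) by (simp add: zero_power)

text \<open>A monomial of degree 1 is a single variable. This makes the values of a degree 1 syzygy
  linear in the parameter.\<close>

lemma mpoly_eval_linear:
  fixes p :: "('a::comm_semiring_1, 'n::finite) mpoly"
  assumes "homogeneous 1 p"
  shows "mpoly_eval p v = (\<Sum>i\<in>UNIV. mpoly_eval p (axis i 1) * v $ i)"
proof -
  have key: "(\<Prod>j\<in>UNIV. (v $ j) ^ Poly_Mapping.lookup m j) =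
      (\<Sum>i\<in>UNIV. (\<Prod>j\<in>UNIV. (axis i 1 $ j) ^ Poly_Mapping.lookup m j) * v $ i)"
    if "m \<in> Poly_Mapping.keys p" for m
  proof -
    have "(\<Sum>j\<in>UNIV. Poly_Mapping.lookup m j) = 1"
      using assms that by (simp add: homogeneous_def)
    then obtain k where k: "Poly_Mapping.lookup m k = 1"
      "\<And>j. j \<noteq> k \<Longrightarrow> Poly_Mapping.lookup m j = 0"
      by (subst (asm) sum_eq_1_iff) auto
    then have m: "m = Poly_Mapping.single k 1"
      by (intro poly_mapping_eqI) (auto simp: lookup_single when_def)
    have eval_k: "(\<Prod>j\<in>UNIV. (w $ j) ^ Poly_Mapping.lookup m j) = w $ k" for w :: "'a ^ 'n"
      using mpoly_eval_variable[of k 1 w] by (simp add: m mpoly_eval_single)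
    have "(\<Sum>i\<in>UNIV. (\<Prod>j\<in>UNIV. (axis i 1 $ j) ^ Poly_Mapping.lookup m j) * v $ i) =
        (\<Sum>i\<in>UNIV. if k = i then v $ i else 0)"
      unfolding eval_k by (intro sum.cong) (auto simp: axis_def)
    then show ?thesis
      using eval_k by simp
  qed
  show ?thesis
    unfolding mpoly_eval_def sum_distrib_right
    by (subst sum.swap) (simp add: key sum_distrib_left mult.assoc)
qed

section \<open>Zeros of forms in two variables\<close>

text \<open>Setting the second variable to 1 loses nothing: the degree is fixed, so the first
  exponent determines the monomial. The resulting univariate polynomial has infinitely many
  roots.\<close>

lemma homogeneous_eq_0:
  fixes f :: "('a::field, 2) mpoly"
  assumes inf: "infinite (UNIV :: 'a set)" and hom: "homogeneous d f"
    and zero: "\<And>v. mpoly_eval f v = 0"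
  shows "f = 0"
proof (rule ccontr)
  assume "f \<noteq> 0"
  then obtain m where m: "m \<in> Poly_Mapping.keys f" by fastforce
  have key_eq: "m' = m" if "m' \<in> Poly_Mapping.keys f"
    "Poly_Mapping.lookup m' 1 = Poly_Mapping.lookup m 1" for m'
  proof (rule poly_mapping_eqI)
    fix k :: 2
    have "Poly_Mapping.lookup m' 1 + Poly_Mapping.lookup m' 2 =
        Poly_Mapping.lookup m 1 + Poly_Mapping.lookup m 2"
      using hom that(1) m unfolding homogeneous_def sum_2 by metis
    with that show "Poly_Mapping.lookup m' k = Poly_Mapping.lookup m k"
      using exhaust_2[of k] by auto
  qed
  define g where "g = (\<Sum>m\<in>Poly_Mapping.keys f. monom (Poly_Mapping.lookup f m) (Poly_Mapping.lookup m 1))"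
  have "poly g x = 0" for x
    using zero[of "vector [x, 1]"]
    by (simp add: g_def mpoly_eval_def UNIV_2 poly_sum poly_monom)
  then have "g = 0"
    using inf poly_roots_finite[of g] by auto
  moreover have "coeff g (Poly_Mapping.lookup m 1) =
      (\<Sum>m'\<in>Poly_Mapping.keys f. if m' = m then Poly_Mapping.lookup f m' else 0)"
    unfolding g_def coeff_sum by (intro sum.cong) (auto dest: key_eq)
  ultimately show False using m by (auto simp: in_keys_iff)
qed

lemma linear_factor_dvd:
  fixes f :: "('a::field, 2) mpoly" and v :: "'a ^ 2" and i j :: 2
  assumes hom: "homogeneous d f" and zero: "mpoly_eval f v = 0"
    and vj: "v $ j \<noteq> 0" and ij: "i \<noteq> j"
  shows "(Poly_Mapping.single (Poly_Mapping.single i 1) (v $ j) -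
    Poly_Mapping.single (Poly_Mapping.single j 1) (v $ i)) dvd f"
proof -
  txt \<open>Modulo the linear form, \<open>v\<^sub>j t\<^sub>i\<close> equals \<open>v\<^sub>i t\<^sub>j\<close>, so \<open>v\<^sub>j\<^sup>d f\<close> is congruent to \<open>f(v) t\<^sub>j\<^sup>d = 0\<close>.\<close>
  let ?c = "Poly_Mapping.single 0 :: 'a \<Rightarrow> ('a, 2) mpoly"
  let ?T = "\<lambda>i::2. Poly_Mapping.single (Poly_Mapping.single i 1) (1::'a)"
  let ?X = "?c (v $ j) * ?T i" and ?Y = "?c (v $ i) * ?T j"
  have UNIV_ij: "UNIV = {i, j}"
    using ij exhaust_2[of i] exhaust_2[of j] by (auto simp: UNIV_2)
  have cmult: "?c (a * b) = ?c a * ?c b" for a b by (simp add: mult_single)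
  have cpow: "?c (a ^ n) = ?c a ^ n" for a n
    by (induction n) (simp_all add: cmult)
  have Tpow: "?T k ^ n = Poly_Mapping.single (Poly_Mapping.single k n) 1" for k n
    by (induction n) (simp_all add: mult_single flip: single_add)
  have monomial: "?X - ?Y dvd ?c (v $ j ^ d) * Poly_Mapping.single m c -
      ?c (c * (\<Prod>k\<in>UNIV. (v $ k) ^ Poly_Mapping.lookup m k)) * ?T j ^ d"
    if m: "m \<in> Poly_Mapping.keys f" for m c
  proof -
    define a b where "a = Poly_Mapping.lookup m i" and "b = Poly_Mapping.lookup m j"
    have d: "d = a + b"
      using hom m ij by (auto simp: homogeneous_def UNIV_ij a_def b_def)
    have "m = Poly_Mapping.single i a + Poly_Mapping.single j b"
    proof (rule poly_mapping_eqI)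
      fix k
      have "k = i \<or> k = j" using UNIV_ij by auto
      then show "Poly_Mapping.lookup m k =
          Poly_Mapping.lookup (Poly_Mapping.single i a + Poly_Mapping.single j b) k"
        using ij by (auto simp: lookup_add lookup_single a_def b_def)
    qed
    then have single: "Poly_Mapping.single m c = ?c c * ?T i ^ a * ?T j ^ b"
      by (simp add: Tpow[unfolded One_nat_def] mult_single)
    have prod: "(\<Prod>k\<in>UNIV. (v $ k) ^ Poly_Mapping.lookup m k) = v $ i ^ a * v $ j ^ b"
      using ij by (simp add: UNIV_ij a_def b_def)
    \<comment> \<open>As \<open>d = a + b\<close>, the factor \<open>v $ j ^ a\<close> turns
      \<open>?T i ^ a\<close> into \<open>?X ^ a\<close>, and \<open>v $ j ^ b\<close> stays in
      front of both terms.\<close>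
    have "?c (v $ j ^ d) * Poly_Mapping.single m c -
        ?c (c * (\<Prod>k\<in>UNIV. (v $ k) ^ Poly_Mapping.lookup m k)) * ?T j ^ d =
        ?c c * ?T j ^ b * ?c (v $ j) ^ b * (?X ^ a - ?Y ^ a)"
      unfolding single prod d cmult cpow power_add power_mult_distrib
      by (simp only: right_diff_distrib mult_ac)
    moreover have "?X - ?Y dvd ?X ^ a - ?Y ^ a"
      by (subst power_diff_sumr2) (rule dvd_triv_left)
    ultimately show ?thesis by (simp only: dvd_mult)
  qed
  have "?X - ?Y dvd (\<Sum>m\<in>Poly_Mapping.keys f.
      ?c (v $ j ^ d) * Poly_Mapping.single m (Poly_Mapping.lookup f m) -
      ?c (Poly_Mapping.lookup f m * (\<Prod>k\<in>UNIV. (v $ k) ^ Poly_Mapping.lookup m k)) * ?T j ^ d)"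
    by (intro dvd_sum monomial)
  also have "\<dots> = ?c (v $ j ^ d) * f - ?c (mpoly_eval f v) * ?T j ^ d"
  proof -
    have csum: "?c (\<Sum>m\<in>A. h m) = (\<Sum>m\<in>A. ?c (h m))" for A and h :: "(2 \<Rightarrow>\<^sub>0 nat) \<Rightarrow> 'a"
      by (induction A rule: infinite_finite_induct) (simp_all add: single_add)
    show ?thesis
      by (simp add: sum_subtractf mpoly_eval_def csum sum_distrib_right
          flip: sum_distrib_left poly_mapping_eq_sum_single)
  qed
  finally have "?X - ?Y dvd ?c (inverse (v $ j) ^ d) * (?c (v $ j ^ d) * f)"
    using zero by simp
  also have "\<dots> = f"
  proof -
    have "?c (inverse (v $ j) ^ d) * ?c (v $ j ^ d) = 1"
      using vj by (simp add: mult_single flip: power_mult_distrib)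
    then show ?thesis by (simp only: mult.assoc[symmetric] mult_1_left)
  qed
  finally show ?thesis by (simp add: mult_single)
qed

text \<open>At a common zero \<open>v\<close>, the linear form vanishing at \<open>v\<close> would
  divide every \<open>u $ i\<close>. It is no unit, because it has a zero. Hence the parametrization
  is defined at every point.\<close>

lemma coprime_no_common_zero:
  fixes u :: "('a::field, 2) mpoly ^ 'm::finite"
  assumes hom: "\<And>i. homogeneous d (u $ i)"
    and cop: "\<And>g. (\<And>i. g dvd u $ i) \<Longrightarrow> g dvd 1" and v: "v \<noteq> 0"
  shows "(\<chi> i. mpoly_eval (u $ i) v) \<noteq> 0"
proof
  assume "(\<chi> i. mpoly_eval (u $ i) v) = 0"
  then have zero: "mpoly_eval (u $ i) v = 0" for i by (simp add: vec_eq_iff)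
  obtain i j :: 2 where ij: "v $ j \<noteq> 0" "i \<noteq> j"
  proof -
    from v obtain j where "v $ j \<noteq> 0" by (auto simp: vec_eq_iff)
    \<comment> \<open>Arithmetic in the type \<open>2\<close> is modulo 2, so \<open>j + 1\<close>
      is the other index.\<close>
    moreover have "j + 1 \<noteq> j" by simp
    ultimately show thesis by (rule that)
  qed
  define l :: "('a, 2) mpoly" where
    "l = Poly_Mapping.single (Poly_Mapping.single i 1) (v $ j) -
      Poly_Mapping.single (Poly_Mapping.single j 1) (v $ i)"
  have "l dvd 1"
    using cop linear_factor_dvd[OF hom zero ij] unfolding l_def by blast
  then obtain k where "1 = l * k" by (elim dvdE)
  then have "1 = mpoly_eval l v * mpoly_eval k v" by (metis mpoly_eval_mult mpoly_eval_one)
  moreover have "mpoly_eval l v = 0"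
    by (simp add: l_def mpoly_eval_diff mpoly_eval_variable[unfolded One_nat_def])
  ultimately show False by simp
qed

section \<open>Curves in projective space\<close>

text \<open>The relation excludes 0, so the class of 0 is empty and is not a projective
  point.\<close>

lemma proj_rel_class_in_proj_space_iff [simp]: "proj_rel `` {v} \<in> proj_space \<longleftrightarrow> v \<noteq> 0"
proof
  assume "proj_rel `` {v} \<in> proj_space"
  then have "proj_rel `` {v} \<noteq> {}"
    unfolding proj_space_def using in_quotient_imp_non_empty[OF equiv_proj_rel] by blast
  then show "v \<noteq> 0" by (auto simp: proj_rel_def)
qed (auto simp: proj_space_def intro: quotientI)

lemma proj_space_cases:
  assumes "P \<in> proj_space"
  obtains v where "v \<noteq> 0" "P = proj_rel `` {v}"
  using assms unfolding proj_space_def by (auto elim: quotientE)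

lemma proj_rel_class_in_nonvanishing_iff:
  assumes "homogeneous k F"
  shows "proj_rel `` {v} \<in> {P \<in> proj_space. \<forall>w\<in>P. mpoly_eval F w \<noteq> 0} \<longleftrightarrow>
    v \<noteq> 0 \<and> mpoly_eval F v \<noteq> 0"
proof -
  have "mpoly_eval F w \<noteq> 0" if "mpoly_eval F v \<noteq> 0" "(v, w) \<in> proj_rel" for w
    using that mpoly_eval_scale[OF assms] by (auto simp: proj_rel_def)
  moreover have "(v, v) \<in> proj_rel" if "v \<noteq> 0"
    using that by (auto simp: proj_rel_def intro: exI[of _ 1])
  ultimately show ?thesis by auto
qed

text \<open>This replaces irreducibility of the curve: two open sets that both meet it share all but
  finitely many parameters, hence meet on it if the field is infinite. The proof is by induction on
  the generation of \<open>T\<close>.\<close>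

lemma finite_curve_outside_zariski_open:
  fixes f :: "'n::finite \<Rightarrow> 'a::field poly"
  assumes "openin zariski T" "proj_rel `` {\<chi> i. poly (f i) s} \<in> T"
  shows "finite {t. proj_rel `` {\<chi> i. poly (f i) t} \<notin> T}"
proof -
  let ?c = "\<lambda>t. \<chi> i. poly (f i) t"
  have "generate_topology_on
      {{P \<in> proj_space. \<forall>v \<in> P. mpoly_eval F v \<noteq> 0} | F :: ('a, 'n) mpoly. \<exists>k. homogeneous k F} T"
    using assms(1) unfolding zariski_def by (rule openin_topology_generated_by)
  then show ?thesis using assms(2)
  proof (induction rule: generate_topology_on.induct)
    case Empty
    then show ?case by simp
  next
    case (Int A B)
    have "{t. proj_rel `` {?c t} \<notin> A \<inter> B} =
        {t. proj_rel `` {?c t} \<notin> A} \<union> {t. proj_rel `` {?c t} \<notin> B}" by blast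
    with Int show ?case by simp
  next
    case (UN K)
    \<comment> \<open>One member of the union that contains the point at \<open>s\<close> already
      misses only finitely many parameters.\<close>
    then obtain A where A: "A \<in> K" "proj_rel `` {?c s} \<in> A" by blast
    show ?case
      by (rule finite_subset[OF _ UN.IH[OF A]]) (use A in blast)
  next
    case (Basis A)
    then obtain F k where F: "A = {P \<in> proj_space. \<forall>v \<in> P. mpoly_eval F v \<noteq> 0}" "homogeneous k F"
      by blast
    note A_iff = proj_rel_class_in_nonvanishing_iff[OF F(2), folded F(1)]
    obtain g where g: "\<And>t. mpoly_eval F (?c t) = poly g t"
      using mpoly_eval_poly_curve by blast
    have s: "?c s \<noteq> 0" "poly g s \<noteq> 0"
      using Basis.prems by (simp_all add: A_iff g)
    \<comment> \<open>The curve may pass through the origin, where it gives no projective point. A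
      coordinate nonzero at \<open>s\<close> bounds the number of such parameters.\<close>
    then obtain i where i: "poly (f i) s \<noteq> 0" by (auto simp: vec_eq_iff)
    have "{t. proj_rel `` {?c t} \<notin> A} \<subseteq> {t. poly g t = 0} \<union> {t. poly (f i) t = 0}"
      by (auto simp: A_iff g vec_eq_iff)
    moreover have "finite ({t. poly g t = 0} \<union> {t. poly (f i) t = 0})"
      using s i by (auto intro!: poly_roots_finite)
    ultimately show ?case by (rule finite_subset)
  qed
qed

text \<open>Each coefficient of \<open>l\<close> times the determinant of \<open>v\<close> and
  \<open>w\<close> is a combination of the two vanishing values, so the determinant is 0.\<close>

lemma proj_rel_class_eq_of_linear_form:
  fixes v w l :: "'a::field ^ 2"
  assumes "v \<noteq> 0" "w \<noteq> 0" "l \<noteq> 0"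
    and v: "(\<Sum>j\<in>UNIV. l $ j * v $ j) = 0" and w: "(\<Sum>j\<in>UNIV. l $ j * w $ j) = 0"
  shows "proj_rel `` {v} = proj_rel `` {w}"
proof -
  have "l $ 1 * (v $ 1 * w $ 2 - v $ 2 * w $ 1) =
      w $ 2 * (\<Sum>j\<in>UNIV. l $ j * v $ j) - v $ 2 * (\<Sum>j\<in>UNIV. l $ j * w $ j)"
    "l $ 2 * (v $ 1 * w $ 2 - v $ 2 * w $ 1) =
      v $ 1 * (\<Sum>j\<in>UNIV. l $ j * w $ j) - w $ 1 * (\<Sum>j\<in>UNIV. l $ j * v $ j)"
    by (simp_all add: sum_2 algebra_simps)
  with \<open>l \<noteq> 0\<close> v w have det: "v $ 1 * w $ 2 = v $ 2 * w $ 1"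
    by (auto simp: vec_eq_iff forall_2)
  have "\<exists>c. w = c *s v"
  proof (cases "v $ 1 = 0")
    case True
    with \<open>v \<noteq> 0\<close> have "v $ 2 \<noteq> 0" by (simp add: vec_eq_iff forall_2)
    with det True show ?thesis
      by (intro exI[of _ "w $ 2 / v $ 2"]) (simp add: vec_eq_iff forall_2 field_simps)
  next
    case False
    with det show ?thesis
      by (intro exI[of _ "w $ 1 / v $ 1"]) (simp add: vec_eq_iff forall_2 field_simps)
  qed
  with assms(1,2) have "(v, w) \<in> proj_rel" by (simp add: proj_rel_def)
  then show ?thesis by (rule equiv_class_eq[OF equiv_proj_rel])
qed

section \<open>Constant syzygies\<close>

lemma no_constant_syzygy:
  fixes u p q :: "('a::field, 2) mpoly ^ 'm::finite"
  assumes inf: "infinite (UNIV :: 'a set)"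
    and u: "\<And>i. homogeneous d (u $ i)"
    and p: "\<And>i. homogeneous k (p $ i)" "k > 0"
    and q: "\<And>i. homogeneous l (q $ i)" "l > 0"
    and span: "syzygies u \<subseteq> module.span (*s) {p, q}"
    and a: "\<And>v. (\<Sum>i\<in>UNIV. a $ i * mpoly_eval (u $ i) v) = 0"
  shows "a = 0"
proof -
  interpret module "(*s) :: ('a, 2) mpoly \<Rightarrow> ('a, 2) mpoly ^ 'm \<Rightarrow> ('a, 2) mpoly ^ 'm"
    by (rule module_vec)
  let ?A = "(\<chi> i. Poly_Mapping.single 0 (a $ i)) :: ('a, 2) mpoly ^ 'm"
  have "(\<Sum>i\<in>UNIV. ?A $ i * u $ i) = 0"
  \<comment> \<open>The hypothesis on \<open>a\<close> concerns values only; over an infinite field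
    it becomes an identity of polynomials.\<close>
  proof (rule homogeneous_eq_0[OF inf])
    have "homogeneous (0 + d) (?A $ i * u $ i)" for i
      using u by (intro homogeneous_mult) (auto intro: homogeneous_single)
    then show "homogeneous d (\<Sum>i\<in>UNIV. ?A $ i * u $ i)"
      by (intro homogeneous_sum) simp
    show "mpoly_eval (\<Sum>i\<in>UNIV. ?A $ i * u $ i) v = 0" for v
      using a by (simp add: mpoly_eval_sum mpoly_eval_mult)
  qed
  then have "?A \<in> span {p, q}"
    using span by (auto simp: syzygies_def)
  \<comment> \<open>Vanishing at the origin defines a submodule; it contains both generators since
    their degrees are positive, while \<open>?A\<close> takes the value \<open>a\<close>
    there.\<close>
  also have "span {p, q} \<subseteq> {x. \<forall>i. mpoly_eval (x $ i) 0 = 0}"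
  proof (rule span_minimal)
    show "{p, q} \<subseteq> {x. \<forall>i. mpoly_eval (x $ i) 0 = 0}"
      using p q by (auto intro: mpoly_eval_at_0)
    show "subspace {x. \<forall>i. mpoly_eval (x $ i) 0 = 0}"
      by (auto intro!: subspaceI simp: mpoly_eval_add mpoly_eval_mult)
  qed
  finally show "a = 0" by (simp add: vec_eq_iff)
qed

section \<open>Generic injectivity for \<open>\<mu> = 1\<close>\<close>

theorem corollary2p2:
  fixes u :: "('a::alg_closed_field, 2) mpoly ^ 3" and d :: nat
  assumes "d \<ge> 1"
    and "\<forall>i. u $ i \<noteq> 0"
    and "\<forall>i. homogeneous d (u $ i)"
    and "\<forall>g. (\<forall>i. g dvd u $ i) \<longrightarrow> g dvd 1"
    and "has_mu u d 1"
  shows "generically_one_to_one u"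
proof -
  note inf = infinite_UNIV_alg_closed_field[where 'a = 'a]
  interpret module "(*s) :: ('a, 2) mpoly \<Rightarrow> ('a, 2) mpoly ^ 3 \<Rightarrow> ('a, 2) mpoly ^ 3"
    by (rule module_vec)
  have hom: "homogeneous d (u $ i)" for i using assms(3) by blast
  \<comment> \<open>The bound \<open>2 * \<mu> \<le> d\<close> makes the degree \<open>d - 1\<close>
    of \<open>q\<close> positive as well.\<close>
  obtain p q where d: "2 \<le> d" and p: "\<And>i. homogeneous 1 (p $ i)"
    and q: "\<And>i. homogeneous (d - 1) (q $ i)"
    and ind: "\<not> dependent {p, q}" and span: "span {p, q} = syzygies u"
    using assms(5) unfolding has_mu_def by auto

  define \<phi> where "\<phi> v = (\<chi> i. mpoly_eval (u $ i) v)" for v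
  define C where "C = param_map u ` proj_space"
  have \<phi>_nz: "\<phi> v \<noteq> 0" if "v \<noteq> 0" for v
    unfolding \<phi>_def using coprime_no_common_zero[OF hom _ that] assms(4) by blast
  have \<phi>_0: "\<phi> 0 = 0"
    using mpoly_eval_at_0[OF hom] d by (simp add: \<phi>_def vec_eq_iff)
  have param: "param_map u (proj_rel `` {v}) = proj_rel `` {\<phi> v}" if "v \<noteq> 0" for v
    unfolding \<phi>_def using param_map_class[OF hom that] .
  have in_C: "proj_rel `` {\<phi> v} \<in> C" if "v \<noteq> 0" for v
    using param[OF that] that unfolding C_def by (metis image_eqI proj_rel_class_in_proj_space_iff)
  have C_cases: "\<exists>v. v \<noteq> 0 \<and> Q = proj_rel `` {\<phi> v}" if "Q \<in> C" for Q
    using that param unfolding C_def by (auto elim!: proj_space_cases)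
  have syzygy: "(\<Sum>i\<in>UNIV. mpoly_eval (p $ i) v * \<phi> v $ i) = 0" for v
  proof -
    have "(\<Sum>i\<in>UNIV. p $ i * u $ i) = 0"
      using span span_base[of p "{p, q}"] by (simp add: syzygies_def)
    then have "mpoly_eval (\<Sum>i\<in>UNIV. p $ i * u $ i) v = 0" by simp
    then show ?thesis by (simp add: \<phi>_def mpoly_eval_sum mpoly_eval_mult)
  qed

  have "p \<noteq> 0" using ind dependent_zero[of "{p, q}"] by auto
  then obtain i where "p $ i \<noteq> 0" by (auto simp: vec_eq_iff)
  then obtain e where e: "mpoly_eval (p $ i) e \<noteq> 0"
    using homogeneous_eq_0[OF inf p] by blast
  \<comment> \<open>\<open>a\<close> is \<open>p(e)\<close>, and \<open>L\<close> is the linear form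
    on \<open>K^3\<close> whose nonvanishing locus \<open>V\<close> is the required open
    set.\<close>
  define a where "a = (\<chi> i. mpoly_eval (p $ i) e)"
  define L :: "('a, 3) mpoly" where
    "L = (\<Sum>i\<in>UNIV. Poly_Mapping.single (Poly_Mapping.single i 1) (a $ i))"
  have homL: "homogeneous 1 L"
    unfolding L_def by (intro homogeneous_sum homogeneous_variable)
  have eval_L: "mpoly_eval L x = (\<Sum>i\<in>UNIV. a $ i * x $ i)" for x
    unfolding L_def mpoly_eval_sum mpoly_eval_variable ..
  have "a \<noteq> 0" using e by (auto simp: a_def vec_eq_iff)
  \<comment> \<open>If \<open>L\<close> vanished at every \<open>\<phi> w\<close>, then
    \<open>a\<close> would be a nonzero constant syzygy.\<close>
  then obtain w where w: "mpoly_eval L (\<phi> w) \<noteq> 0"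
    using no_constant_syzygy[OF inf hom p _ q, of a] d span
    by (fastforce simp: eval_L \<phi>_def)

  define V where "V = {P \<in> proj_space. \<forall>x\<in>P. mpoly_eval L x \<noteq> 0}"
  have V_iff: "proj_rel `` {x} \<in> V \<longleftrightarrow> x \<noteq> 0 \<and> mpoly_eval L x \<noteq> 0" for x
    unfolding V_def by (rule proj_rel_class_in_nonvanishing_iff[OF homL])
  have openV: "openin zariski V"
    unfolding zariski_def V_def using homL by (intro topology_generated_by_Basis) blast
  have "\<phi> w \<noteq> 0" using w by (auto simp: eval_L)
  with w have wV: "proj_rel `` {\<phi> w} \<in> V" by (simp add: V_iff)

  show ?thesis
    unfolding generically_one_to_one_def for_generic_def C_def[symmetric]
  proof (intro exI[of _ "V \<inter> C"] conjI ballI)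
    show "openin (subtopology zariski C) (V \<inter> C)"
      using openV by (rule openin_subtopology_Int)
  next
    show "subtopology zariski C closure_of (V \<inter> C) = C"
    proof
      show "subtopology zariski C closure_of (V \<inter> C) \<subseteq> C"
        by (rule closure_of_subset_subtopology)
      have "C \<subseteq> proj_space" using C_cases \<phi>_nz by fastforce
      moreover have "\<exists>y. y \<in> V \<inter> C \<and> y \<in> T"
        if Q: "Q \<in> C" "Q \<in> T" and T: "openin (subtopology zariski C) T" for Q T
      proof -
        obtain T' where T': "openin zariski T'" "T = T' \<inter> C"
          using T by (auto simp: openin_subtopology)
        obtain v where v: "Q = proj_rel `` {\<phi> v}" using C_cases[OF Q(1)] by blast
        \<comment> \<open>The line from \<open>v\<close> at \<open>t = 0\<close> to \<open>w\<close>
          at \<open>t = 1\<close>: its image meets \<open>T'\<close> at the first parameter and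
          \<open>V\<close> at the second.\<close>
        define c where "c t = (\<chi> j. poly [:v $ j, w $ j - v $ j:] t)" for t
        have "\<exists>g. \<forall>t. mpoly_eval (u $ i) (c t) = poly g t" for i
          unfolding c_def by (rule mpoly_eval_poly_curve)
        then obtain f where "\<And>i t. mpoly_eval (u $ i) (c t) = poly (f i) t" by metis
        then have \<phi>c: "\<phi> (c t) = (\<chi> i. poly (f i) t)" for t by (simp add: \<phi>_def)
        have c01: "c 0 = v" "c 1 = w" by (simp_all add: c_def vec_eq_iff)
        have "finite {t. proj_rel `` {\<phi> (c t)} \<notin> T'}"
          using finite_curve_outside_zariski_open[OF T'(1), of f 0] Q T' v c01
          unfolding \<phi>c[symmetric] by simp
        moreover have "finite {t. proj_rel `` {\<phi> (c t)} \<notin> V}"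
          using finite_curve_outside_zariski_open[OF openV, of f 1] wV c01
          unfolding \<phi>c[symmetric] by simp
        ultimately have "finite ({t. proj_rel `` {\<phi> (c t)} \<notin> T'} \<union> {t. proj_rel `` {\<phi> (c t)} \<notin> V})"
          by blast
        then obtain t where t: "proj_rel `` {\<phi> (c t)} \<in> T'" "proj_rel `` {\<phi> (c t)} \<in> V"
          using ex_new_if_finite[OF inf] by blast
        \<comment> \<open>The line may contain the origin, but \<open>\<phi> 0 = 0\<close>
          represents no point of \<open>V\<close>.\<close>
        then have "c t \<noteq> 0" using \<phi>_0 by (auto simp: V_iff)
        with t T' in_C show ?thesis by blast
      qed
      ultimately show "C \<subseteq> subtopology zariski C closure_of (V \<inter> C)"
        by (auto simp: in_closure_of topspace_zariski)
    qed
  next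
    fix Q assume "Q \<in> V \<inter> C"
    then obtain v where v: "v \<noteq> 0" "Q = proj_rel `` {\<phi> v}" "mpoly_eval L (\<phi> v) \<noteq> 0"
      using C_cases V_iff by blast
    \<comment> \<open>The coefficients of the linear form
      \<open>x \<mapsto> p(x) \<bullet> \<phi>(v)\<close>, read off at the unit vectors.\<close>
    define l where "l = (\<chi> j. \<Sum>i\<in>UNIV. mpoly_eval (p $ i) (axis j 1) * \<phi> v $ i)"
    have l: "(\<Sum>j\<in>UNIV. l $ j * x $ j) = (\<Sum>i\<in>UNIV. mpoly_eval (p $ i) x * \<phi> v $ i)" for x
    proof -
      have "(\<Sum>i\<in>UNIV. mpoly_eval (p $ i) x * \<phi> v $ i) =
          (\<Sum>i\<in>UNIV. \<Sum>j\<in>UNIV. mpoly_eval (p $ i) (axis j 1) * x $ j * \<phi> v $ i)"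
        by (subst mpoly_eval_linear[OF p]) (simp only: sum_distrib_right)
      then show ?thesis
        by (subst (asm) sum.swap) (simp add: l_def sum_distrib_left mult_ac)
    qed
    \<comment> \<open>At \<open>e\<close> this form takes the value \<open>L(\<phi>(v))\<close>,
      which is nonzero.\<close>
    have "l \<noteq> 0"
      using v(3) l[of e] by (auto simp: eval_L a_def)
    have "P = proj_rel `` {v}" if P: "P \<in> proj_space" "param_map u P = Q" for P
    proof -
      obtain x where x: "x \<noteq> 0" "P = proj_rel `` {x}" using P(1) by (rule proj_space_cases)
      with P v have "proj_rel `` {\<phi> x} = proj_rel `` {\<phi> v}" by (simp add: param)
      then have "(\<phi> x, \<phi> v) \<in> proj_rel"
        by (rule eq_equiv_class[OF _ equiv_proj_rel]) (use \<phi>_nz v in simp)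
      then obtain c where "\<phi> v = c *s \<phi> x" by (auto simp: proj_rel_def)
      \<comment> \<open>Replacing \<open>\<phi> v\<close> by a multiple of \<open>\<phi> x\<close>
        turns the value of the form at \<open>x\<close> into the syzygy relation at
        \<open>x\<close>. At \<open>v\<close> the form vanishes by the same relation, so
        \<open>x\<close> and \<open>v\<close> span the same line.\<close>
      then have "(\<Sum>j\<in>UNIV. l $ j * x $ j) = c * (\<Sum>i\<in>UNIV. mpoly_eval (p $ i) x * \<phi> x $ i)"
        by (simp add: l sum_distrib_left mult_ac)
      then have "(\<Sum>j\<in>UNIV. l $ j * x $ j) = 0" by (simp add: syzygy)
      with \<open>l \<noteq> 0\<close> v(1) x show ?thesis
        by (simp add: proj_rel_class_eq_of_linear_form[of x v l] l syzygy)
    qed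
    then have "{P \<in> proj_space. param_map u P = Q} = {proj_rel `` {v}}"
      using v param by auto
    then show "card {P \<in> proj_space. param_map u P = Q} = 1" by simp
  qed
qed

end
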